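(* Let $r\geq 2$ be an integer, let $n\geq 1$ be an integer, let $U_{1},\ldots,U_{r}$ be sets of size $n$, and let $M\subset U_{1}\times\cdots\times U_{r}$ satisfy $|M|\geq\alpha n^{r}$, where $\alpha$ is a real number. If $$2^{r}\exp\left(-\frac{1}{r}(\ln n)^{1/r}\right)\leq\alpha\leq 1$$ and the positive integers $s_{1},\ldots,s_{r}$ satisfy $1\leq s_{1}s_2\cdots s_{r}\leq\ln n$, then $$\left|B_{M}(s_{1},\ldots,s_{r})\right|\geq\left(\frac{\alpha}{2^{r}}\right)^{r s_{1}s_2\cdots s_{r}}\binom{n}{s_{1}}\cdots\binom{n}{s_{r}}.$$
   Context: For nonempty sets $U_{1},\ldots,U_{r}$, a set $M\subset U_{1}\times\cdots\times U_{r}$, and positive integers $s_{1},\ldots,s_{r}$ with $|U_{i}|\geq s_{i}$ for $1\leq i\leq r$, $B_{M}(s_{1},\ldots,s_{r})$ denotes the set of all products $V_{1}\times\cdots\times V_{r}\subset M$ such that $V_{i}\subset U_{i}$ and $|V_{i}|=s_{i}$ for $1\leq i\leq r$. The sets $U_i$ are not assumed to be disjoint or distinct; the symbol $\subset$ allows equality; $\ln$ is the natural logarithm. *)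

theory Defs
  imports Complex_Main "HOL-Library.FuncSet"
begin

text \<open>
  Elements of \<open>U\<^sub>1 \<times> \<dots> \<times> U\<^sub>r\<close> are represented by extensional functions on \<open>{1..r}\<close>.
  The set collects the products themselves, not the tuples \<open>(V\<^sub>1, \<dots>, V\<^sub>r)\<close>; a box has a unique
  tuple of factors when all \<open>s i\<close> are positive.
\<close>

definition boxes :: "nat \<Rightarrow> (nat \<Rightarrow> 'a set) \<Rightarrow> (nat \<Rightarrow> 'a) set \<Rightarrow> (nat \<Rightarrow> nat) \<Rightarrow> (nat \<Rightarrow> 'a) set set"
  where "boxes r U M s =
    {Pi\<^sub>E {1..r} V | V. Pi\<^sub>E {1..r} V \<subseteq> M \<and> (\<forall>i\<in>{1..r}. V i \<subseteq> U i \<and> card (V i) = s i)}"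

end

theory Submission
  imports Defs "HOL-Analysis.Harmonic_Numbers"
begin

text \<open>
  Put \<open>b = \<alpha> / 2 ^ r\<close>. One proves, by induction on the number \<open>k\<close> of coordinates, that a nonempty
  \<open>M\<close> with at least \<open>2 b k n ^ k\<close> elements contains at least
  \<open>b ^ (k s\<^sub>1 \<dots> s\<^sub>k) (n choose s\<^sub>1) \<dots> (n choose s\<^sub>k)\<close> boxes; the threshold, linear in \<open>k\<close>, lets the
  induction start at \<open>k = 0\<close>, and \<open>2 r \<le> 2 ^ r\<close> recovers the claim. In the step at least \<open>2 b n\<close> slices of \<open>M\<close> meet the
  threshold, so double counting bounds below the average number of slices containing a given
  box of the lower dimension, and convexity bounds the number of ways to choose \<open>s\<^sub>k\<close> of them.
  This needs \<open>s\<^sub>k\<close> to be at most half that average, which holds because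
  the coordinates are added in increasing order of \<open>s\<^sub>i\<close>: then \<open>s\<^sub>1 \<dots> s\<^sub>k\<^sub>-\<^sub>1\<close> is at most
  \<open>(ln n) ^ ((r - 1) / r)\<close>, while \<open>\<alpha> \<le> 1\<close> forces \<open>ln n\<close> to be large.
\<close>

section \<open>Factor tuples and slices\<close>

text \<open>An arbitrary index set lets the induction add coordinates in any order. Extensionality
  makes each tuple unique, so tuples can be counted.\<close>

definition box_factors :: "'i set \<Rightarrow> ('i \<Rightarrow> 'a set) \<Rightarrow> ('i \<Rightarrow> 'a) set \<Rightarrow> ('i \<Rightarrow> nat) \<Rightarrow> ('i \<Rightarrow> 'a set) set"
  where "box_factors I U M s =
    {V \<in> Pi\<^sub>E I (\<lambda>i. {A. A \<subseteq> U i \<and> card A = s i}). Pi\<^sub>E I V \<subseteq> M}"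

definition slice :: "'i set \<Rightarrow> ('i \<Rightarrow> 'a set) \<Rightarrow> ('i \<Rightarrow> 'a) set \<Rightarrow> 'i \<Rightarrow> 'a \<Rightarrow> ('i \<Rightarrow> 'a) set"
  where "slice I U M x u = {f \<in> Pi\<^sub>E I U. f(x := u) \<in> M}"

lemma finite_box_factors:
  assumes "finite I" and "\<And>i. i \<in> I \<Longrightarrow> finite (U i)"
  shows "finite (box_factors I U M s)"
proof (rule finite_subset)
  show "box_factors I U M s \<subseteq> Pi\<^sub>E I (\<lambda>i. {A. A \<subseteq> U i \<and> card A = s i})"
    by (auto simp: box_factors_def)
  show "finite (Pi\<^sub>E I (\<lambda>i. {A. A \<subseteq> U i \<and> card A = s i}))"
    using assms by (intro finite_PiE) auto
qed

lemma inj_on_fun_upd_PiE: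
  assumes "x \<notin> I"
  shows "inj_on (\<lambda>(V, A). V(x := A)) (Pi\<^sub>E I T \<times> B)"
proof (rule inj_onI, clarify)
  fix V V' A A' assume V: "V \<in> Pi\<^sub>E I T" "V' \<in> Pi\<^sub>E I T" and eq: "V(x := A) = V'(x := A')"
  from V assms have "V x = undefined" "V' x = undefined" by auto
  with eq show "V = V' \<and> A = A'"
    by (metis fun_upd_same fun_upd_triv fun_upd_upd)
qed

lemma card_eq_sum_slices:
  assumes "finite I" and "x \<notin> I" and fin: "\<And>i. i \<in> insert x I \<Longrightarrow> finite (U i)"
    and M: "M \<subseteq> Pi\<^sub>E (insert x I) U"
  shows "card M = (\<Sum>u\<in>U x. card (slice I U M x u))"
proof -
  let ?S = "SIGMA u:U x. slice I U M x u"
  let ?g = "\<lambda>(u, f). f(x := u)"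
  have "M = ?g ` ?S"
  proof (rule set_eqI)
    fix f
    show "f \<in> M \<longleftrightarrow> f \<in> ?g ` ?S"
    proof
      assume f: "f \<in> M"
      then have "f \<in> Pi\<^sub>E (insert x I) U" using M by blast
      \<comment> \<open>For extensional functions, resetting \<open>x\<close> to
        \<open>undefined\<close> is restriction to \<open>I\<close>.\<close>
      then have "(f x, f(x := undefined)) \<in> ?S"
        using f assms(2) fun_upd_in_PiE[OF assms(2)] by (auto simp: slice_def)
      then have "?g (f x, f(x := undefined)) \<in> ?g ` ?S" by (rule imageI)
      then show "f \<in> ?g ` ?S" by simp
    qed (auto simp: slice_def)
  qed
  moreover have "inj_on ?g ?S"
  proof -
    have "inj_on (\<lambda>(V, A). V(x := A)) (Pi\<^sub>E I U \<times> U x)"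
      using assms(2) by (rule inj_on_fun_upd_PiE)
    then show ?thesis by (auto simp: inj_on_def slice_def)
  qed
  ultimately have "card M = card ?S" by (metis card_image)
  also have "\<dots> = (\<Sum>u\<in>U x. card (slice I U M x u))"
  proof (rule card_SigmaI)
    show "finite (U x)" using fin by simp
    have "finite (Pi\<^sub>E I U)" using assms(1) fin by (intro finite_PiE) auto
    then show "\<forall>u\<in>U x. finite (slice I U M x u)" by (simp add: slice_def)
  qed
  finally show ?thesis .
qed

section \<open>Double counting boxes through slices\<close>

text \<open>Any \<open>s x\<close> points whose slices all contain the box of \<open>V\<close> may
  serve as the factor at \<open>x\<close>; distinct choices give distinct tuples.\<close>

lemma sum_codegree_choose_le_card_box_factors:
  assumes "finite I" and "x \<notin> I" and fin: "\<And>i. i \<in> insert x I \<Longrightarrow> finite (U i)"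
  shows "(\<Sum>V\<in>Pi\<^sub>E I (\<lambda>i. {A. A \<subseteq> U i \<and> card A = s i}).
      card {u \<in> U x. Pi\<^sub>E I V \<subseteq> slice I U M x u} choose s x)
    \<le> card (box_factors (insert x I) U M s)"
proof -
  let ?T = "Pi\<^sub>E I (\<lambda>i. {A. A \<subseteq> U i \<and> card A = s i})"
  let ?d = "\<lambda>V. {u \<in> U x. Pi\<^sub>E I V \<subseteq> slice I U M x u}"
  let ?S = "SIGMA V:?T. {A. A \<subseteq> ?d V \<and> card A = s x}"
  let ?g = "\<lambda>(V, A). V(x := A)"
  have finU: "finite (U x)" using fin by simp
  have finT: "finite ?T" using assms(1) fin by (intro finite_PiE) auto
  have "(\<Sum>V\<in>?T. card (?d V) choose s x) = (\<Sum>V\<in>?T. card {A. A \<subseteq> ?d V \<and> card A = s x})"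
    using finU by (intro sum.cong refl) (simp add: n_subsets)
  also have "\<dots> = card ?S"
    using finT finU by (intro card_SigmaI[symmetric]) auto
  also have "\<dots> = card (?g ` ?S)"
  proof (rule card_image[symmetric])
    have "inj_on (\<lambda>(V, A). V(x := A)) (?T \<times> UNIV)"
      using assms(2) by (rule inj_on_fun_upd_PiE)
    then show "inj_on ?g ?S" by (rule inj_on_subset) auto
  qed
  also have "\<dots> \<le> card (box_factors (insert x I) U M s)"
  proof (rule card_mono)
    show "finite (box_factors (insert x I) U M s)"
      using assms(1) fin by (intro finite_box_factors) auto
    show "?g ` ?S \<subseteq> box_factors (insert x I) U M s"
    proof clarify
      fix V A assume V: "V \<in> ?T" and A: "A \<subseteq> ?d V" "card A = s x"
      have "V(x := A) \<in> Pi\<^sub>E (insert x I) (\<lambda>i. {A. A \<subseteq> U i \<and> card A = s i})"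
        using V A by (intro PiE_fun_upd) auto
      moreover have "f \<in> M" if f: "f \<in> Pi\<^sub>E (insert x I) (V(x := A))" for f
      proof -
        have "f x \<in> A" using f by (auto dest: PiE_mem)
        then have "Pi\<^sub>E I V \<subseteq> slice I U M x (f x)" using A by auto
        moreover have "Pi\<^sub>E I (V(x := A)) = Pi\<^sub>E I V"
          using assms(2) by (intro PiE_cong) auto
        then have "f(x := undefined) \<in> Pi\<^sub>E I V" using fun_upd_in_PiE[OF assms(2) f] by simp
        ultimately have "f(x := undefined) \<in> slice I U M x (f x)" by blast
        then show ?thesis by (simp add: slice_def)
      qed
      ultimately show "V(x := A) \<in> box_factors (insert x I) U M s"
        by (auto simp: box_factors_def)
    qed
  qed
  finally show ?thesis .
qed

text \<open>Both sides count the pairs \<open>(V, u)\<close> for which the slice at \<open>u\<close>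
  contains the box of \<open>V\<close>.\<close>

lemma sum_codegree_eq:
  assumes "finite I" and fin: "\<And>i. i \<in> insert x I \<Longrightarrow> finite (U i)"
  shows "(\<Sum>V\<in>Pi\<^sub>E I (\<lambda>i. {A. A \<subseteq> U i \<and> card A = s i}).
      card {u \<in> U x. Pi\<^sub>E I V \<subseteq> slice I U M x u})
    = (\<Sum>u\<in>U x. card (box_factors I U (slice I U M x u) s))"
  unfolding box_factors_def
  using assms by (intro sum_multicount_gen) (auto intro!: finite_PiE)

section \<open>Convexity bound for sums of binomial coefficients\<close>

text \<open>The right side is the falling factorial of \<open>d\<close>, whose \<open>s\<close>
  factors are at least \<open>d + 1 - s\<close>. For \<open>s > d\<close> truncation makes the base
  0, and \<open>1 \<le> s\<close> makes its power 0.\<close>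

lemma power_le_fact_mult_choose:
  fixes d s :: nat
  assumes "1 \<le> s"
  shows "(d + 1 - s) ^ s \<le> fact s * (d choose s)"
proof (cases "s \<le> d")
  case True
  have "Suc m ^ k \<le> fact k * (m + k choose k)" for m k :: nat
  proof (induction k)
    case (Suc k)
    have "Suc m ^ Suc k \<le> Suc (m + k) * (fact k * (m + k choose k))"
      unfolding power_Suc using Suc.IH by (intro mult_le_mono) auto
    also have "\<dots> = fact k * (Suc k * (Suc (m + k) choose Suc k))"
      unfolding Suc_times_binomial by (simp only: mult_ac)
    also have "\<dots> = fact (Suc k) * (m + Suc k choose Suc k)"
      by (simp only: fact_Suc of_nat_id add_Suc_right mult_ac)
    finally show ?case .
  qed simp
  from this[of "d - s" s] True show ?thesis by (simp add: Suc_diff_le)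
next
  case False
  then show ?thesis using assms by (simp add: power_0_left)
qed

text \<open>
  Replaces convexity of the binomial coefficient: \<open>(d + 1 - s) ^ s / fact s\<close>, with truncated
  subtraction, is a convex minorant of \<open>d choose s\<close>, to which Bernoulli's inequality applies.
\<close>
lemma sum_choose_ge:
  fixes d :: "'v \<Rightarrow> nat" and c :: real
  assumes s: "1 \<le> s" and sc: "real s \<le> c" and n: "0 < n"
    and avg: "2 * c * real (card T) \<le> (\<Sum>V\<in>T. real (d V))"
  shows "(c / real n) ^ s * real (n choose s) * real (card T) \<le> (\<Sum>V\<in>T. real (d V choose s))"
proof -
  let ?y = "\<lambda>V. real (d V + 1 - s)"
  have c: "0 < c" using s sc by simp
  have "(\<Sum>V\<in>T. real (d V)) - c * real (card T) = (\<Sum>V\<in>T. real (d V) - c)"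
    by (simp add: sum_subtractf)
  \<comment> \<open>Since \<open>s \<le> c\<close>, passing from \<open>d V\<close> to
    \<open>?y V\<close> costs at most \<open>c\<close>, half of the assumed average
    \<open>2 * c\<close>.\<close>
  also have "\<dots> \<le> (\<Sum>V\<in>T. ?y V)" using sc by (intro sum_mono) linarith
  finally have sum_y: "c * real (card T) \<le> (\<Sum>V\<in>T. ?y V)" using avg by linarith
  have "real (card T) \<le> (\<Sum>V\<in>T. ?y V) / c" using c sum_y by (simp add: field_simps)
  then have "real s * real (card T) \<le> real s * ((\<Sum>V\<in>T. ?y V) / c)"
    by (rule mult_left_mono) simp
  \<comment> \<open>The term \<open>1 + s (y / c - 1)\<close> is the tangent of
    \<open>(y / c) ^ s\<close> at \<open>y = c\<close>; by \<open>sum_y\<close> these tangent values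
    sum to at least \<open>card T\<close>.\<close>
  then have "real (card T) \<le> real (card T) + real s * ((\<Sum>V\<in>T. ?y V) / c - real (card T))"
    by (simp add: algebra_simps)
  also have "\<dots> = (\<Sum>V\<in>T. 1 + real s * (?y V / c - 1))"
    by (simp add: sum.distrib sum_distrib_left[symmetric] sum_subtractf sum_divide_distrib)
  also have "\<dots> \<le> (\<Sum>V\<in>T. (?y V / c) ^ s)"
  proof (rule sum_mono)
    fix V
    have "1 + real s * (?y V / c - 1) \<le> (1 + (?y V / c - 1)) ^ s"
      by (rule Bernoulli_inequality) (use c in simp)
    then show "1 + real s * (?y V / c - 1) \<le> (?y V / c) ^ s" by simp
  qed
  finally have "c ^ s * real (card T) \<le> c ^ s * (\<Sum>V\<in>T. (?y V / c) ^ s)"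
    using c by (intro mult_left_mono) auto
  also have "\<dots> = (\<Sum>V\<in>T. ?y V ^ s)"
    using c by (simp add: sum_distrib_left power_divide)
  also have "\<dots> \<le> (\<Sum>V\<in>T. fact s * real (d V choose s))"
  proof (rule sum_mono)
    fix V
    have "real ((d V + 1 - s) ^ s) \<le> real (fact s * (d V choose s))"
      using power_le_fact_mult_choose[OF s] by (rule of_nat_mono)
    then show "?y V ^ s \<le> fact s * real (d V choose s)" by simp
  qed
  finally have main: "c ^ s * real (card T) \<le> fact s * (\<Sum>V\<in>T. real (d V choose s))"
    by (simp add: sum_distrib_left)
  \<comment> \<open>This trades \<open>1 / fact s\<close> for a binomial coefficient, the form that
    the product bound requires.\<close>
  have "real ((n choose s) * fact s) \<le> real (n ^ s)"
    using binomial_fact_pow by (rule of_nat_mono)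
  then have "real (n choose s) / real n ^ s \<le> 1 / fact s"
    using n by (simp add: field_simps)
  then have "c ^ s * real (card T) * (real (n choose s) / real n ^ s)
      \<le> c ^ s * real (card T) * (1 / fact s)"
    using c by (intro mult_left_mono) auto
  also have "\<dots> \<le> (\<Sum>V\<in>T. real (d V choose s))" using main by (simp add: field_simps)
  finally show ?thesis by (simp add: power_divide mult_ac)
qed

section \<open>The step from \<open>I\<close> to \<open>insert x I\<close>\<close>

text \<open>Averaging: if every slice used up the threshold \<open>?a\<close>, there would still
  remain \<open>2 * b * n\<close> times the full size \<open>?N\<close>, and only rich slices can
  exceed \<open>?a\<close>. Nonemptiness is required separately because the threshold is 0 when
  \<open>I\<close> is empty.\<close>

lemma card_rich_slices:
  assumes "finite I" and "x \<notin> I" and U: "\<And>i. i \<in> insert x I \<Longrightarrow> finite (U i) \<and> card (U i) = n"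
    and n: "0 < n" and M: "M \<subseteq> Pi\<^sub>E (insert x I) U" and b: "0 \<le> b"
    and M_card: "2 * b * real (card (insert x I)) * real n ^ card (insert x I) \<le> real (card M)"
  shows "2 * b * real n \<le> real (card {u \<in> U x. slice I U M x u \<noteq> {} \<and>
      2 * b * real (card I) * real n ^ card I \<le> real (card (slice I U M x u))})"
proof -
  let ?N = "real n ^ card I"
  let ?a = "2 * b * real (card I) * ?N"
  let ?W = "{u \<in> U x. slice I U M x u \<noteq> {} \<and> ?a \<le> real (card (slice I U M x u))}"
  have a: "0 \<le> ?a" using b by simp
  have finU: "finite (U x)" and cardU: "card (U x) = n" using U by auto
  have N: "0 < ?N" using n by simp
  have card_PiE_U: "card (Pi\<^sub>E I U) = n ^ card I"
  proof -
    have "card (Pi\<^sub>E I U) = (\<Prod>i\<in>I. n)"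
      unfolding card_PiE[OF assms(1)] using U by (intro prod.cong) auto
    then show ?thesis by simp
  qed
  have le: "real (card (slice I U M x u)) \<le> ?N" for u
  proof -
    have "card (slice I U M x u) \<le> card (Pi\<^sub>E I U)"
      using assms(1) U by (intro card_mono finite_PiE) (auto simp: slice_def)
    then show ?thesis unfolding card_PiE_U by (metis of_nat_mono of_nat_power)
  qed
  have "?a * real n + 2 * b * real n * ?N = 2 * b * real (card (insert x I)) * real n ^ card (insert x I)"
    using assms(1,2) by (simp add: algebra_simps)
  also have "\<dots> \<le> real (card M)" by (rule M_card)
  also have "\<dots> = (\<Sum>u\<in>U x. real (card (slice I U M x u)))"
    using card_eq_sum_slices[OF assms(1,2) _ M] U by simp
  also have "\<dots> \<le> (\<Sum>u\<in>U x. ?a + (if u \<in> ?W then ?N else 0))"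
  proof (rule sum_mono)
    fix u assume u: "u \<in> U x"
    show "real (card (slice I U M x u)) \<le> ?a + (if u \<in> ?W then ?N else 0)"
    proof (cases "u \<in> ?W")
      case True
      show ?thesis unfolding if_P[OF True] using a le[of u] by linarith
    next
      case False
      then consider "slice I U M x u = {}" | "real (card (slice I U M x u)) < ?a"
        using u by auto
      then show ?thesis using a False by cases auto
    qed
  qed
  also have "\<dots> = ?a * real n + real (card ?W) * ?N"
  proof -
    have "(\<Sum>u\<in>U x. if u \<in> ?W then ?N else 0) = (\<Sum>u\<in>U x \<inter> ?W. ?N)"
      using finU by (simp only: sum.inter_restrict)
    also have "U x \<inter> ?W = ?W" by blast
    finally show ?thesis using cardU by (simp add: sum.distrib)
  qed
  finally have "2 * b * real n * ?N \<le> real (card ?W) * ?N" by linarith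
  then show ?thesis using N mult_le_cancel_right_pos by blast
qed

lemma card_box_factors_step:
  fixes b :: real
  assumes I: "finite I" and x: "x \<notin> I"
    and U: "\<And>i. i \<in> insert x I \<Longrightarrow> finite (U i) \<and> card (U i) = n"
    and n: "0 < n" and M: "M \<subseteq> Pi\<^sub>E (insert x I) U" and b: "0 < b" "b \<le> 1"
    and s: "\<And>i. i \<in> insert x I \<Longrightarrow> 1 \<le> s i"
    and M_card: "2 * b * real (card (insert x I)) * real n ^ card (insert x I) \<le> real (card M)"
    and sx: "real (s x) \<le> b ^ (card I * (\<Prod>i\<in>I. s i) + 1) * real n"
    and IH: "\<And>M. M \<subseteq> Pi\<^sub>E I U \<Longrightarrow> M \<noteq> {} \<Longrightarrow>
      2 * b * real (card I) * real n ^ card I \<le> real (card M) \<Longrightarrow>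
      b ^ (card I * (\<Prod>i\<in>I. s i)) * (\<Prod>i\<in>I. real (n choose s i)) \<le> real (card (box_factors I U M s))"
  shows "b ^ (card (insert x I) * (\<Prod>i\<in>insert x I. s i)) * (\<Prod>i\<in>insert x I. real (n choose s i))
    \<le> real (card (box_factors (insert x I) U M s))"
proof -
  let ?T = "Pi\<^sub>E I (\<lambda>i. {A. A \<subseteq> U i \<and> card A = s i})"
  let ?d = "\<lambda>V. card {u \<in> U x. Pi\<^sub>E I V \<subseteq> slice I U M x u}"
  let ?p = "\<Prod>i\<in>I. s i" and ?k = "card I"
  let ?e = "b ^ (?k * ?p)"
  let ?W = "{u \<in> U x. slice I U M x u \<noteq> {} \<and> 2 * b * real ?k * real n ^ ?k \<le> real (card (slice I U M x u))}"
  \<comment> \<open>Half the guaranteed average codegree: at least \<open>2 * b * n\<close> rich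
    slices each contain at least a fraction \<open>?e\<close> of the boxes indexed by
    \<open>?T\<close>.\<close>
  define c where "c = b ^ (?k * ?p + 1) * real n"
  have finU: "finite (U x)" using U by simp
  have fin: "\<And>i. i \<in> insert x I \<Longrightarrow> finite (U i)" using U by simp
  have card_T: "real (card ?T) = (\<Prod>i\<in>I. real (n choose s i))"
  proof -
    have "card ?T = (\<Prod>i\<in>I. n choose s i)"
      unfolding card_PiE[OF I] using U by (intro prod.cong refl) (simp add: n_subsets)
    then show ?thesis by simp
  qed
  have "2 * c * real (card ?T) = (2 * b * real n) * (?e * real (card ?T))"
    by (simp add: c_def)
  also have "\<dots> \<le> real (card ?W) * (?e * real (card ?T))"
    using card_rich_slices[OF I x U n M _ M_card] b by (intro mult_right_mono) auto
  also have "\<dots> = (\<Sum>u\<in>?W. ?e * real (card ?T))" by simp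
  also have "\<dots> \<le> (\<Sum>u\<in>?W. real (card (box_factors I U (slice I U M x u) s)))"
    unfolding card_T by (intro sum_mono IH) (auto simp: slice_def)
  also have "\<dots> \<le> (\<Sum>u\<in>U x. real (card (box_factors I U (slice I U M x u) s)))"
    using finU by (intro sum_mono2) auto
  also have "\<dots> = (\<Sum>V\<in>?T. real (?d V))"
  proof -
    have "(\<Sum>V\<in>?T. ?d V) = (\<Sum>u\<in>U x. card (box_factors I U (slice I U M x u) s))"
      using I fin by (rule sum_codegree_eq)
    then show ?thesis by (simp flip: of_nat_sum)
  qed
  finally have avg: "2 * c * real (card ?T) \<le> (\<Sum>V\<in>?T. real (?d V))" .
  have sx1: "1 \<le> s x" using s by simp
  have p1: "1 \<le> ?p" using s by (intro prod_ge_1) auto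
  \<comment> \<open>As \<open>1 \<le> ?p\<close>, the extra 1 is absorbed by raising
    \<open>?k\<close> to \<open>?k + 1\<close>; since \<open>b \<le> 1\<close>, the larger exponent
    gives the weaker bound.\<close>
  have "(?k * ?p + 1) * s x \<le> card (insert x I) * (\<Prod>i\<in>insert x I. s i)"
    using I x p1 by (simp add: algebra_simps)
  then have "b ^ (card (insert x I) * (\<Prod>i\<in>insert x I. s i)) \<le> b ^ ((?k * ?p + 1) * s x)"
    using b by (intro power_decreasing) auto
  also have "\<dots> = (c / real n) ^ s x"
    unfolding power_mult using n by (simp add: c_def)
  finally have "b ^ (card (insert x I) * (\<Prod>i\<in>insert x I. s i)) * (\<Prod>i\<in>insert x I. real (n choose s i))
      \<le> (c / real n) ^ s x * (\<Prod>i\<in>insert x I. real (n choose s i))"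
    by (intro mult_right_mono prod_nonneg) auto
  also have "\<dots> = (c / real n) ^ s x * real (n choose s x) * real (card ?T)"
    using I x by (simp add: card_T)
  also have "\<dots> \<le> (\<Sum>V\<in>?T. real (?d V choose s x))"
    using sx1 _ n avg by (rule sum_choose_ge) (use sx in \<open>simp add: c_def\<close>)
  also have "\<dots> \<le> real (card (box_factors (insert x I) U M s))"
  proof -
    have "(\<Sum>V\<in>?T. ?d V choose s x) \<le> card (box_factors (insert x I) U M s)"
      using I x fin by (rule sum_codegree_choose_le_card_box_factors)
    then show ?thesis by (simp flip: of_nat_sum)
  qed
  finally show ?thesis .
qed

section \<open>Numerical estimate for the largest side\<close>

text \<open>
  Since \<open>m\<close> bounds every factor of \<open>p\<close>, either \<open>p \<le> t ^ (r - 1)\<close> directly, or \<open>m < t\<close> because of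
  \<open>p m \<le> t ^ r\<close>, and then \<open>p \<le> m ^ k\<close> gives the same bound.
\<close>
lemma size_le_power_mult:
  fixes t b :: real and p m k n r :: nat
  assumes r: "2 \<le> r" and t: "real r ^ 2 * ln 2 \<le> t" and n: "0 < n" and ln_n: "ln (real n) = t ^ r"
    and b: "exp (- t / real r) \<le> b"
    and k: "k < r" and p: "p \<le> m ^ k" and p1: "1 \<le> p" and pm: "real (p * m) \<le> t ^ r"
  shows "real m \<le> b ^ (k * p + 1) * real n"
proof -
  have "4 * (2 / 3) \<le> real r ^ 2 * ln 2"
  proof (rule mult_mono)
    show "4 \<le> (real r)\<^sup>2" using r power_mono[of 2 "real r" 2] by simp
  qed (use ln2_ge_two_thirds in auto)
  then have t83: "8 / 3 \<le> t" using t by simp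
  have "real r ^ 2 * (2 / 3) \<le> real r ^ 2 * ln 2"
    using ln2_ge_two_thirds by (intro mult_left_mono) auto
  then have r2: "real r ^ 2 \<le> 3 / 2 * t" using t by simp
  have tr: "t ^ r = t * t ^ (r - 1)" using r by (simp flip: power_Suc)
  have p_le: "real p \<le> t ^ (r - 1)"
  proof (rule ccontr)
    assume "\<not> real p \<le> t ^ (r - 1)"
    then have gt: "t ^ (r - 1) < real p" by simp
    have "real m \<le> t"
    proof (rule ccontr)
      assume "\<not> real m \<le> t"
      then have "t ^ (r - 1) * t < real p * real m"
        using gt t83 p1 by (intro mult_strict_mono) auto
      then show False using pm tr by (simp add: mult.commute)
    qed
    then have "real m ^ k \<le> t ^ k" by (intro power_mono) auto
    also have "\<dots> \<le> t ^ (r - 1)" using k t83 by (intro power_increasing) auto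
    finally show False using p gt by (metis le_less_trans less_le_not_le of_nat_le_iff of_nat_power)
  qed
  \<comment> \<open>Expanding \<open>ln\<close> at 2 instead of 1 halves the slope, to 3/4 after the
    factor 3/2, so the bound holds once \<open>t\<close> is at least 13/6.\<close>
  have ln_t: "3 / 2 * ln t \<le> t - 1"
  proof -
    have "ln t = ln 2 + ln (t / 2)" using t83 by (simp add: ln_div)
    also have "\<dots> \<le> 25 / 36 + (t / 2 - 1)"
      using t83 by (intro add_mono ln2_le_25_over_36 ln_le_minus_one) auto
    finally show ?thesis using t83 by simp
  qed
  have "t ^ 1 \<le> t ^ (r - 1)" using r t83 by (intro power_increasing) auto
  then have "real r ^ 2 * ln t \<le> t * (t ^ (r - 1) - 1)"
  proof -
    assume le: "t ^ 1 \<le> t ^ (r - 1)"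
    have "real r ^ 2 * ln t \<le> 3 / 2 * t * ln t" using r2 t83 by (intro mult_right_mono) auto
    also have "\<dots> = t * (3 / 2 * ln t)" by simp
    also have "\<dots> \<le> t * (t ^ (r - 1) - 1)" using ln_t le t83 by (intro mult_left_mono) auto
    finally show ?thesis .
  qed
  \<comment> \<open>The logarithm of the goal when every bound is extreme:
    \<open>b = exp (- t / r)\<close>, \<open>k = r - 1\<close>, \<open>p = t ^ (r - 1)\<close>, and
    \<open>m\<close> estimated crudely by \<open>t ^ r\<close>.\<close>
  then have key: "real r * ln t \<le> (t ^ r - t) / real r"
    using r by (simp add: tr field_simps power2_eq_square)
  have "real k * real p \<le> real (r - 1) * t ^ (r - 1)"
    using k p_le by (intro mult_mono) auto
  then have "t * (real k * real p + 1) \<le> t * (real (r - 1) * t ^ (r - 1) + 1)"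
    using t83 by (intro mult_left_mono) auto
  also have "\<dots> = real r * t ^ r - t ^ r + t" using r by (simp add: tr of_nat_diff algebra_simps)
  finally have "t * (real k * real p + 1) / real r \<le> (real r * t ^ r - t ^ r + t) / real r"
    using r by (intro divide_right_mono) auto
  also have "\<dots> = t ^ r - (t ^ r - t) / real r" using r by (simp add: field_simps)
  finally have expo: "(t ^ r - t) / real r \<le> t ^ r - t / real r * (real k * real p + 1)"
    by simp
  have "real m \<le> real (p * m)" using p1 by (intro of_nat_mono) simp
  also have "\<dots> \<le> t ^ r" by (rule pm)
  also have "\<dots> = exp (real r * ln t)" using t83 by (simp add: exp_of_nat_mult)
  also have "\<dots> \<le> exp (t ^ r - t / real r * (real k * real p + 1))" using key expo by simp
  also have "\<dots> = exp (- t / real r) ^ (k * p + 1) * exp (t ^ r)"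
    by (simp add: exp_of_nat_mult[symmetric] exp_add[symmetric] algebra_simps)
  also have "exp (t ^ r) = real n" using n ln_n by (metis exp_ln of_nat_0_less_iff)
  also have "exp (- t / real r) ^ (k * p + 1) * real n \<le> b ^ (k * p + 1) * real n"
    using b by (intro mult_right_mono power_mono) auto
  finally show ?thesis .
qed

section \<open>Induction and conclusion\<close>

text \<open>Ranking induction inserts an index with maximal \<open>s x\<close>, hence the product
  over \<open>I\<close> is at most \<open>s x ^ card I\<close>, as \<open>size_le_power_mult\<close>
  needs. \<open>M\<close> stays general because the hypothesis is applied to slices.\<close>

lemma card_box_factors_ge:
  fixes b t :: real and s :: "'i \<Rightarrow> nat"
  assumes r: "2 \<le> r" and t: "real r ^ 2 * ln 2 \<le> t" and n: "0 < n" and ln_n: "ln (real n) = t ^ r"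
    and b: "exp (- t / real r) \<le> b" "b \<le> 1"
    and "finite I" and "card I \<le> r"
    and "\<And>i. i \<in> I \<Longrightarrow> finite (U i) \<and> card (U i) = n"
    and "\<And>i. i \<in> I \<Longrightarrow> 1 \<le> s i" and "real (\<Prod>i\<in>I. s i) \<le> t ^ r"
    and "M \<subseteq> Pi\<^sub>E I U" and "M \<noteq> {}"
    and "2 * b * real (card I) * real n ^ card I \<le> real (card M)"
  shows "b ^ (card I * (\<Prod>i\<in>I. s i)) * (\<Prod>i\<in>I. real (n choose s i)) \<le> real (card (box_factors I U M s))"
  using assms(7-)
proof (induction I arbitrary: M rule: finite_ranking_induct[where f = s])
  case empty
  \<comment> \<open>The only point over no coordinates lies in the nonempty \<open>M\<close>, so
    both sides are 1.\<close>
  then have "box_factors {} U M s = {\<lambda>_. undefined}" by (auto simp: box_factors_def)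
  then show ?case by simp
next
  case (insert x I)
  show ?case
  proof (cases "x \<in> I")
    case True
    then show ?thesis using insert by (simp add: insert_absorb)
  next
    case False
    have b0: "0 < b" using b(1) exp_gt_zero less_le_trans by blast
    have prod_le: "(\<Prod>i\<in>I. s i) \<le> s x ^ card I"
      using insert.hyps prod_mono[of I s "\<lambda>_. s x"] by simp
    have prod_insert: "(\<Prod>i\<in>insert x I. s i) = (\<Prod>i\<in>I. s i) * s x"
      using insert.hyps False by simp
    have sx: "1 \<le> s x" using insert.prems by simp
    have p1: "1 \<le> (\<Prod>i\<in>I. s i)" using insert.prems by (intro prod_ge_1) auto
    have card_I: "card I < r" using insert.prems insert.hyps False by simp
    have "real (\<Prod>i\<in>I. s i) \<le> real (\<Prod>i\<in>insert x I. s i)"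
      unfolding prod_insert using sx by (intro of_nat_mono) simp
    then have prod_I: "real (\<Prod>i\<in>I. s i) \<le> t ^ r" using insert.prems by linarith
    show ?thesis
    proof (rule card_box_factors_step)
      show "real (s x) \<le> b ^ (card I * (\<Prod>i\<in>I. s i) + 1) * real n"
        using r t n ln_n b(1) card_I prod_le p1 by (rule size_le_power_mult)
          (use insert.prems(4) prod_insert in simp)
      fix M assume "M \<subseteq> Pi\<^sub>E I U" "M \<noteq> {}" "2 * b * real (card I) * real n ^ card I \<le> real (card M)"
      then show "b ^ (card I * (\<Prod>i\<in>I. s i)) * (\<Prod>i\<in>I. real (n choose s i)) \<le> real (card (box_factors I U M s))"
        using insert.prems card_I prod_I by (intro insert.IH) auto
    qed (use insert.prems insert.hyps False n b b0 in auto)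
  qed
qed

text \<open>Positive sizes make all factors nonempty, so a product determines its factors and no box
  is counted twice.\<close>

lemma card_box_factors_le_card_boxes:
  assumes U: "\<And>i. i \<in> {1..r} \<Longrightarrow> finite (U i)" and M: "M \<subseteq> Pi\<^sub>E {1..r} U"
    and s: "\<And>i. i \<in> {1..r} \<Longrightarrow> 1 \<le> s i"
  shows "card (box_factors {1..r} U M s) \<le> card (boxes r U M s)"
proof (rule card_inj_on_le)
  show "inj_on (Pi\<^sub>E {1..r}) (box_factors {1..r} U M s)"
  proof (rule inj_onI)
    fix V V' assume V: "V \<in> box_factors {1..r} U M s" "V' \<in> box_factors {1..r} U M s"
      and eq: "Pi\<^sub>E {1..r} V = Pi\<^sub>E {1..r} V'"
    have "V i \<noteq> {}" if i: "i \<in> {1..r}" for i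
    proof -
      have "card (V i) = s i" using V(1) i by (auto simp: box_factors_def dest: PiE_mem)
      then show ?thesis using s[OF i] by auto
    qed
    then have "\<forall>i\<in>{1..r}. V i = V' i" using eq unfolding PiE_eq_iff by blast
    then show "V = V'" using V by (auto simp: box_factors_def intro: PiE_ext)
  qed
  show "Pi\<^sub>E {1..r} ` box_factors {1..r} U M s \<subseteq> boxes r U M s"
  proof (rule image_subsetI)
    fix V assume V: "V \<in> box_factors {1..r} U M s"
    then have "\<forall>i\<in>{1..r}. V i \<subseteq> U i \<and> card (V i) = s i"
      by (auto simp: box_factors_def dest: PiE_mem)
    then show "Pi\<^sub>E {1..r} V \<in> boxes r U M s"
      using V unfolding boxes_def box_factors_def by blast
  qed
  have "finite M" using U M by (meson finite_PiE finite_atLeastAtMost finite_subset)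
  moreover have "boxes r U M s \<subseteq> Pow M" by (auto simp: boxes_def)
  ultimately show "finite (boxes r U M s)" by (meson finite_Pow_iff finite_subset)
qed

theorem theorem4:
  fixes r n :: nat
    and U :: "nat \<Rightarrow> 'a set"
    and M :: "(nat \<Rightarrow> 'a) set"
    and \<alpha> :: real
    and s :: "nat \<Rightarrow> nat"
  assumes "r \<ge> 2" and "n \<ge> 1"
    and "\<And>i. i \<in> {1..r} \<Longrightarrow> finite (U i) \<and> card (U i) = n"
    and "M \<subseteq> Pi\<^sub>E {1..r} U"
    and "real (card M) \<ge> \<alpha> * real n ^ r"
    and "2 ^ r * exp (- (1 / real r) * ln (real n) powr (1 / real r)) \<le> \<alpha>"
    and "\<alpha> \<le> 1"
    and "\<And>i. i \<in> {1..r} \<Longrightarrow> s i \<ge> 1"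
    and "1 \<le> (\<Prod>i = 1..r. s i)"
    and "real (\<Prod>i = 1..r. s i) \<le> ln (real n)"
  shows "real (card (boxes r U M s))
    \<ge> (\<alpha> / 2 ^ r) ^ (r * (\<Prod>i = 1..r. s i)) * (\<Prod>i = 1..r. real (n choose s i))"
proof -
  define t where "t = ln (real n) powr (1 / real r)"
  define b where "b = \<alpha> / 2 ^ r"
  have n1: "1 \<le> ln (real n)" using assms(9,10) by linarith
  have tr: "ln (real n) = t ^ r"
    using n1 assms(1) by (simp add: t_def powr_realpow[symmetric] powr_powr)
  have b: "exp (- t / real r) \<le> b"
    using assms(6) by (simp add: b_def t_def field_simps)
  then have b0: "0 < b" using exp_gt_zero less_le_trans by blast
  have "b \<le> (1 / 2) ^ r" using assms(7) by (simp add: b_def power_one_over field_simps)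
  \<comment> \<open>Here \<open>\<alpha> \<le> 1\<close> forces \<open>n\<close> to be large: taking
    logarithms of this inequality gives the lower bound on \<open>t\<close>.\<close>
  then have "exp (- t / real r) \<le> (1 / 2) ^ r" using b by linarith
  then have "- t / real r \<le> ln ((1 / 2) ^ r)" using ln_ge_iff by simp
  also have "\<dots> = - (real r * ln 2)" by (simp add: ln_realpow ln_div)
  finally have t: "real r ^ 2 * ln 2 \<le> t"
    using assms(1) by (simp add: field_simps power2_eq_square)
  have b1: "b \<le> 1" using \<open>b \<le> (1 / 2) ^ r\<close> power_le_one[of "1 / 2 :: real" r] by simp
  have "2 * r \<le> 2 ^ r" using assms(1)
  proof (induction r rule: dec_induct)
    case (step m)
    then show ?case by simp
  qed simp
  then have "2 * real r \<le> 2 ^ r" by (metis of_nat_mono of_nat_mult of_nat_numeral of_nat_power)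
  then have "b * (2 * real r) * real n ^ r \<le> b * 2 ^ r * real n ^ r"
    using b0 by (intro mult_right_mono mult_left_mono) auto
  also have "\<dots> \<le> real (card M)" using assms(5) by (simp add: b_def)
  finally have M_card: "2 * b * real (card {1..r}) * real n ^ card {1..r} \<le> real (card M)"
    by (simp add: mult_ac)
  moreover have "0 < 2 * b * real (card {1..r}) * real n ^ card {1..r}"
    using b0 assms(1,2) by simp
  ultimately have "M \<noteq> {}" by force
  then have "b ^ (card {1..r} * (\<Prod>i = 1..r. s i)) * (\<Prod>i = 1..r. real (n choose s i))
      \<le> real (card (box_factors {1..r} U M s))"
    using assms t tr b b1 M_card by (intro card_box_factors_ge[where r = r and t = t]) auto
  also have "\<dots> \<le> real (card (boxes r U M s))"
    using assms by (intro of_nat_mono card_box_factors_le_card_boxes) auto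
  finally show ?thesis by (simp add: b_def)
qed

end
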